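(* Let $(X,T)$ be a topological dynamical system and $s>0$. Let $\Phi=(\varphi_n)_{n\in\mathbb N}$ and $\Psi=(\psi_n)_{n\in\mathbb N}$ be two almost additive sequences for $T$. (1) If $\Phi\le\Psi$, then $PD_i(s,T,\Phi)\le PD_i(s,T,\Psi)$ for $i=1,2,3,4$. (2) If $s>1$, then $PD_i(s,T,\Phi+\Psi\circ T-\Psi)=PD_i(s,T,\Phi)$ for $i=1,2,3,4$. (3) $PD_3(s,T,\cdot)$ is convex on almost additive sequences, i.e. $PD_3(s,T,t\Phi+(1-t)\Psi)\le t\,PD_3(s,T,\Phi)+(1-t)\,PD_3(s,T,\Psi)$ for all $t\in[0,1]$.
   Context: A topological dynamical system $(X,T)$ (or $(X,d,T)$) is a compact metric space $(X,d)$ with a continuous map $T:X\to X$. A sequence $\Phi=(\varphi_n)_{n\in\mathbb N}$ ($\mathbb N=\{1,2,\dots\}$) of continuous functions $\varphi_n:X\to\mathbb R$ is almost additive for $T$ if there is a constant $C>0$ with $$-C+\varphi_n(x)+\varphi_m(T^n x)\le\varphi_{n+m}(x)\le\varphi_n(x)+\varphi_m(T^n x)+C$$ for all $n,m\in\mathbb N$, $x\in X$. Sums and scalar multiples of sequences are taken termwise: $\Phi+\Psi\circ T-\Psi=(\varphi_n+\psi_n\circ T-\psi_n)_{n\in\mathbb N}$, $t\Phi+(1-t)\Psi=(t\varphi_n+(1-t)\psi_n)_{n\in\mathbb N}$. $\Phi\le\Psi$ means $\varphi_n(x)\le\psi_n(x)$ for all $n\in\mathbb N$, $x\in X$. Let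 $\mathcal C_X$ be the set of finite open covers of $X$; for $\alpha\in\mathcal C_X$, $\bigvee_{i=0}^{n-1}T^{-i}\alpha=\{A_0\cap T^{-1}A_1\cap\dots\cap T^{-(n-1)}A_{n-1}:A_j\in\alpha\}$. Let $d_n(x,y)=\max_{0\le j<n}d(T^jx,T^jy)$. $F\subseteq X$ is $(n,\epsilon)$-spanning if for each $x\in X$ there is $y\in F$ with $d_n(x,y)<\epsilon$; $E\subseteq X$ is $(n,\epsilon)$-separated if $d_n(x,y)>\epsilon$ for all distinct $x,y\in E$. Put - $q_n(T,\Phi,\alpha)=\inf\{\sum_{B\in\beta}\inf_{x\in B}e^{\varphi_n(x)}:\beta\text{ a finite subcover of }\bigvee_{i=0}^{n-1}T^{-i}\alpha\}$, - $p_n(T,\Phi,\alpha)=\inf\{\sum_{B\in\beta}\sup_{x\in B}e^{\varphi_n(x)}:\beta\text{ a finite subcover of }\bigvee_{i=0}^{n-1}T^{-i}\alpha\}$, - $Q_n(T,\Phi,\epsilon)=\inf\{\sum_{x\in F}e^{\varphi_n(x)}:F\text{ is }(n,\epsilon)\text{-spanning}\}$, - $P_n(T,\Phi,\epsilon)=\sup\{\sum_{x\in E}e^{\varphi_n(x)}:E\text{ is }(n,\epsilon)\text{-separated}\}$. The $s$-topological pressures, with values in $[-\infty,+\infty]$, are $PD_1(s,T,\Phi)=\sup_{\alpha\in\mathcal C_X}\limsup_{n\to\infty}\frac1{n^s}\log q_n(T,\Phi,\alpha)$, $PD_2(s,T,\Phi)=\lim_{\epsilon\to0}\limsup_{n\to\infty}\frac1{n^s}\log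 Q_n(T,\Phi,\epsilon)$, $PD_3(s,T,\Phi)=\lim_{\epsilon\to0}\limsup_{n\to\infty}\frac1{n^s}\log P_n(T,\Phi,\epsilon)$, $PD_4(s,T,\Phi)=\sup_{\alpha\in\mathcal C_X}\limsup_{n\to\infty}\frac1{n^s}\log p_n(T,\Phi,\alpha)$. *)

theory Defs
  imports "HOL-Analysis.Analysis"
begin

text \<open>
  A topological dynamical system is a compact subset \<open>X\<close> of a metric space together with a
  continuous self-map \<open>T\<close> of \<open>X\<close>; every compact metric space is of this form. Topological notions
  on \<open>X\<close> are relative to \<open>X\<close>. Sequences \<open>(\<phi>\<^sub>n)\<^sub>n\<close> are functions \<^typ>\<open>nat \<Rightarrow> 'a \<Rightarrow> real\<close> that only matter
  at indices \<open>n \<ge> 1\<close> and points of \<open>X\<close>.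
\<close>

definition tds :: "'a::metric_space set \<Rightarrow> ('a \<Rightarrow> 'a) \<Rightarrow> bool" where
  "tds X T \<longleftrightarrow> compact X \<and> continuous_on X T \<and> T \<in> X \<rightarrow> X"

definition almost_additive ::
    "'a::metric_space set \<Rightarrow> ('a \<Rightarrow> 'a) \<Rightarrow> (nat \<Rightarrow> 'a \<Rightarrow> real) \<Rightarrow> bool" where
  "almost_additive X T \<phi> \<longleftrightarrow>
     (\<forall>n\<ge>1. continuous_on X (\<phi> n)) \<and>
     (\<exists>C>0. \<forall>n\<ge>1. \<forall>m\<ge>1. \<forall>x\<in>X.
        - C + \<phi> n x + \<phi> m ((T ^^ n) x) \<le> \<phi> (n + m) x \<and>
        \<phi> (n + m) x \<le> \<phi> n x + \<phi> m ((T ^^ n) x) + C)"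

definition seq_le ::
    "'a set \<Rightarrow> (nat \<Rightarrow> 'a \<Rightarrow> real) \<Rightarrow> (nat \<Rightarrow> 'a \<Rightarrow> real) \<Rightarrow> bool" where
  "seq_le X \<phi> \<psi> \<longleftrightarrow> (\<forall>n\<ge>1. \<forall>x\<in>X. \<phi> n x \<le> \<psi> n x)"

definition finite_open_covers :: "'a::metric_space set \<Rightarrow> 'a set set set" where
  "finite_open_covers X =
     {\<alpha>. finite \<alpha> \<and> (\<forall>A\<in>\<alpha>. openin (top_of_set X) A) \<and> \<Union>\<alpha> = X}"

definition join_cover ::
    "'a set \<Rightarrow> ('a \<Rightarrow> 'a) \<Rightarrow> nat \<Rightarrow> 'a set set \<Rightarrow> 'a set set" where
  "join_cover X T n \<alpha> = {{x \<in> X. \<forall>i<n. (T ^^ i) x \<in> A i} | A. \<forall>i<n. A i \<in> \<alpha>}"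

definition finite_subcovers :: "'a set \<Rightarrow> 'a set set \<Rightarrow> 'a set set set" where
  "finite_subcovers X \<gamma> = {\<beta>. \<beta> \<subseteq> \<gamma> \<and> finite \<beta> \<and> \<Union>\<beta> = X}"

definition bowen_dist :: "('a::metric_space \<Rightarrow> 'a) \<Rightarrow> nat \<Rightarrow> 'a \<Rightarrow> 'a \<Rightarrow> real" where
  "bowen_dist T n x y = Max ((\<lambda>j. dist ((T ^^ j) x) ((T ^^ j) y)) ` {0..<n})"

definition spanning ::
    "'a::metric_space set \<Rightarrow> ('a \<Rightarrow> 'a) \<Rightarrow> nat \<Rightarrow> real \<Rightarrow> 'a set \<Rightarrow> bool" where
  "spanning X T n \<epsilon> F \<longleftrightarrow> F \<subseteq> X \<and> (\<forall>x\<in>X. \<exists>y\<in>F. bowen_dist T n x y < \<epsilon>)"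

definition separated ::
    "'a::metric_space set \<Rightarrow> ('a \<Rightarrow> 'a) \<Rightarrow> nat \<Rightarrow> real \<Rightarrow> 'a set \<Rightarrow> bool" where
  "separated X T n \<epsilon> E \<longleftrightarrow> E \<subseteq> X \<and> (\<forall>x\<in>E. \<forall>y\<in>E. x \<noteq> y \<longrightarrow> bowen_dist T n x y > \<epsilon>)"

text \<open>
  The partition functions are taken in \<^typ>\<open>ennreal\<close>. Thus an empty member of a cover contributes
  \<open>\<infinity>\<close> to \<open>cover_inf\<close> (it can be dropped from any subcover, so it never affects the
  infimum) and \<open>0\<close> to \<open>cover_sup\<close>. Spanning and separated sets are not required to be finite, and
  the sums over them are unordered sums with values in \<open>[0, \<infinity>]\<close>.
\<close>

definition cover_inf ::
    "'a set \<Rightarrow> ('a \<Rightarrow> 'a) \<Rightarrow> (nat \<Rightarrow> 'a \<Rightarrow> real) \<Rightarrow> nat \<Rightarrow> 'a set set \<Rightarrow> ennreal" where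
  "cover_inf X T \<phi> n \<alpha> =
     (INF \<beta>\<in>finite_subcovers X (join_cover X T n \<alpha>).
        \<Sum>B\<in>\<beta>. INF x\<in>B. ennreal (exp (\<phi> n x)))"

definition cover_sup ::
    "'a set \<Rightarrow> ('a \<Rightarrow> 'a) \<Rightarrow> (nat \<Rightarrow> 'a \<Rightarrow> real) \<Rightarrow> nat \<Rightarrow> 'a set set \<Rightarrow> ennreal" where
  "cover_sup X T \<phi> n \<alpha> =
     (INF \<beta>\<in>finite_subcovers X (join_cover X T n \<alpha>).
        \<Sum>B\<in>\<beta>. SUP x\<in>B. ennreal (exp (\<phi> n x)))"

definition spanning_inf ::
    "'a::metric_space set \<Rightarrow> ('a \<Rightarrow> 'a) \<Rightarrow> (nat \<Rightarrow> 'a \<Rightarrow> real) \<Rightarrow> nat \<Rightarrow> real \<Rightarrow> ennreal" where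
  "spanning_inf X T \<phi> n \<epsilon> =
     (INF F\<in>{F. spanning X T n \<epsilon> F}. \<Sum>\<^sub>\<infinity>x\<in>F. ennreal (exp (\<phi> n x)))"

definition separated_sup ::
    "'a::metric_space set \<Rightarrow> ('a \<Rightarrow> 'a) \<Rightarrow> (nat \<Rightarrow> 'a \<Rightarrow> real) \<Rightarrow> nat \<Rightarrow> real \<Rightarrow> ennreal" where
  "separated_sup X T \<phi> n \<epsilon> =
     (SUP E\<in>{E. separated X T n \<epsilon> E}. \<Sum>\<^sub>\<infinity>x\<in>E. ennreal (exp (\<phi> n x)))"

definition ln_ennreal :: "ennreal \<Rightarrow> ereal" where
  "ln_ennreal a =
     (if a = 0 then - \<infinity> else if a = \<infinity> then \<infinity> else ereal (ln (enn2real a)))"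

definition growth_rate :: "real \<Rightarrow> (nat \<Rightarrow> ennreal) \<Rightarrow> ereal" where
  "growth_rate s a = limsup (\<lambda>n. ereal (1 / real n powr s) * ln_ennreal (a n))"

definition PD1 ::
    "real \<Rightarrow> 'a::metric_space set \<Rightarrow> ('a \<Rightarrow> 'a) \<Rightarrow> (nat \<Rightarrow> 'a \<Rightarrow> real) \<Rightarrow> ereal" where
  "PD1 s X T \<phi> = (SUP \<alpha>\<in>finite_open_covers X. growth_rate s (\<lambda>n. cover_inf X T \<phi> n \<alpha>))"

definition PD2 ::
    "real \<Rightarrow> 'a::metric_space set \<Rightarrow> ('a \<Rightarrow> 'a) \<Rightarrow> (nat \<Rightarrow> 'a \<Rightarrow> real) \<Rightarrow> ereal" where
  "PD2 s X T \<phi> = Lim (at_right 0) (\<lambda>\<epsilon>. growth_rate s (\<lambda>n. spanning_inf X T \<phi> n \<epsilon>))"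

definition PD3 ::
    "real \<Rightarrow> 'a::metric_space set \<Rightarrow> ('a \<Rightarrow> 'a) \<Rightarrow> (nat \<Rightarrow> 'a \<Rightarrow> real) \<Rightarrow> ereal" where
  "PD3 s X T \<phi> = Lim (at_right 0) (\<lambda>\<epsilon>. growth_rate s (\<lambda>n. separated_sup X T \<phi> n \<epsilon>))"

definition PD4 ::
    "real \<Rightarrow> 'a::metric_space set \<Rightarrow> ('a \<Rightarrow> 'a) \<Rightarrow> (nat \<Rightarrow> 'a \<Rightarrow> real) \<Rightarrow> ereal" where
  "PD4 s X T \<phi> = (SUP \<alpha>\<in>finite_open_covers X. growth_rate s (\<lambda>n. cover_sup X T \<phi> n \<alpha>))"

text \<open>
  Pitfall for convexity statements: in \<^typ>\<open>ereal\<close>, \<open>0 * \<infinity> = 0\<close> and \<open>\<infinity> + (- \<infinity>) = \<infinity>\<close>. For \<open>s < 1\<close> the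
  pressures may take both infinite values, so a convex combination of two pressures can be such an
  indeterminate sum; read as an upper bound it is then vacuous.
\<close>

end

theory Submission
  imports Defs
begin

text \<open>
  If \<open>\<theta>\<^sub>n \<le> \<phi>\<^sub>n + K\<close> uniformly in \<open>n\<close>, every partition function grows by a factor of at most
  \<open>e\<^sup>K\<close>, which is invisible at the scale \<open>n\<^sup>s\<close>. With \<open>K = 0\<close> this is monotonicity. Comparing
  the two splittings \<open>n + 1 = 1 + n\<close> in the almost additivity of \<open>\<Psi>\<close> shows that
  \<open>\<psi>\<^sub>n \<circ> T - \<psi>\<^sub>n\<close> is bounded by \<open>2 (C + sup \<bar>\<psi>\<^sub>1\<bar>)\<close>, which gives invariance under
  coboundaries. Convexity is Hoelder's inequality for the sums over separated sets.
\<close>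

section \<open>Constant factors under infima, suprema and infinite sums in
  \<open>ennreal\<close>\<close>

lemma le_cmult_INF_ennreal:
  fixes f g :: "'b \<Rightarrow> ennreal"
  assumes "\<And>x. x \<in> I \<Longrightarrow> f x \<le> ennreal (exp K) * g x"
  shows "(INF x\<in>I. f x) \<le> ennreal (exp K) * (INF x\<in>I. g x)"
proof -
  \<comment> \<open>An invertible factor is what makes the estimate survive an empty index set,
    where both infima are \<open>top\<close>: the factor \<open>0\<close> would fail there. Empty
    cover members in \<open>cover_inf\<close> produce this case.\<close>
  have inv: "ennreal (exp (- K)) * (ennreal (exp K) * a) = a"
       "ennreal (exp K) * (ennreal (exp (- K)) * a) = a" for a
    by (simp_all flip: mult.assoc ennreal_mult exp_add)
  have "ennreal (exp (- K)) * (INF x\<in>I. f x) \<le> (INF x\<in>I. g x)"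
  proof (rule INF_greatest)
    fix x assume x: "x \<in> I"
    have "(INF x\<in>I. f x) \<le> ennreal (exp K) * g x"
      using INF_lower[OF x] assms[OF x] by (rule order.trans)
    then have "ennreal (exp (- K)) * (INF x\<in>I. f x) \<le> ennreal (exp (- K)) * (ennreal (exp K) * g x)"
      by (rule mult_left_mono) simp
    then show "ennreal (exp (- K)) * (INF x\<in>I. f x) \<le> g x"
      by (simp only: inv)
  qed
  then have "ennreal (exp K) * (ennreal (exp (- K)) * (INF x\<in>I. f x)) \<le> ennreal (exp K) * (INF x\<in>I. g x)"
    by (intro mult_left_mono) auto
  then show ?thesis by (simp only: inv)
qed

lemma le_cmult_SUP_ennreal:
  fixes f g :: "'b \<Rightarrow> ennreal"
  assumes "\<And>x. x \<in> I \<Longrightarrow> f x \<le> c * g x"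
  shows "(SUP x\<in>I. f x) \<le> c * (SUP x\<in>I. g x)"
  unfolding SUP_mult_left_ennreal by (rule SUP_mono) (use assms in blast)

text \<open>An infinite sum in \<open>ennreal\<close> is the supremum of its finite partial sums,
  and both finite sums and suprema commute with \<open>c\<close>, even when values are
  infinite.\<close>

lemma infsum_cmult_right_ennreal:
  fixes f :: "'b \<Rightarrow> ennreal"
  shows "(\<Sum>\<^sub>\<infinity>x\<in>A. c * f x) = c * (\<Sum>\<^sub>\<infinity>x\<in>A. f x)"
  by (simp add: nonneg_infsum_complete SUP_mult_left_ennreal sum_distrib_left)

lemma le_cmult_infsum_ennreal:
  fixes f g :: "'b \<Rightarrow> ennreal"
  assumes "\<And>x. x \<in> A \<Longrightarrow> f x \<le> c * g x"
  shows "(\<Sum>\<^sub>\<infinity>x\<in>A. f x) \<le> c * (\<Sum>\<^sub>\<infinity>x\<in>A. g x)"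
  unfolding infsum_cmult_right_ennreal[symmetric] by (intro infsum_mono nonneg_summable_on_complete assms) auto

lemma exp_le_cmult_exp:
  assumes "\<theta> \<le> \<phi> + K"
  shows "ennreal (exp \<theta>) \<le> ennreal (exp K) * ennreal (exp \<phi>)"
  using assms by (simp flip: ennreal_mult exp_add add: ennreal_leI add.commute)

lemma finite_subcovers_subset: "\<beta> \<in> finite_subcovers X \<gamma> \<Longrightarrow> B \<in> \<beta> \<Longrightarrow> B \<subseteq> X"
  by (auto simp: finite_subcovers_def)

section \<open>Comparison of the four partition functions at a fixed index \<open>n\<close>\<close>

context
  fixes X :: "'a::metric_space set" and T :: "'a \<Rightarrow> 'a" and \<phi> \<theta> :: "nat \<Rightarrow> 'a \<Rightarrow> real"
    and n :: nat and K :: real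
  assumes le: "\<And>x. x \<in> X \<Longrightarrow> \<theta> n x \<le> \<phi> n x + K"
begin

lemma cover_inf_le_cmult: "cover_inf X T \<theta> n \<alpha> \<le> ennreal (exp K) * cover_inf X T \<phi> n \<alpha>"
  unfolding cover_inf_def
proof (rule le_cmult_INF_ennreal)
  fix \<beta> assume \<beta>: "\<beta> \<in> finite_subcovers X (join_cover X T n \<alpha>)"
  show "(\<Sum>B\<in>\<beta>. INF x\<in>B. ennreal (exp (\<theta> n x)))
      \<le> ennreal (exp K) * (\<Sum>B\<in>\<beta>. INF x\<in>B. ennreal (exp (\<phi> n x)))"
    unfolding sum_distrib_left using finite_subcovers_subset[OF \<beta>]
    by (intro sum_mono le_cmult_INF_ennreal exp_le_cmult_exp le) auto
qed

lemma cover_sup_le_cmult: "cover_sup X T \<theta> n \<alpha> \<le> ennreal (exp K) * cover_sup X T \<phi> n \<alpha>"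
  unfolding cover_sup_def
proof (rule le_cmult_INF_ennreal)
  fix \<beta> assume \<beta>: "\<beta> \<in> finite_subcovers X (join_cover X T n \<alpha>)"
  show "(\<Sum>B\<in>\<beta>. SUP x\<in>B. ennreal (exp (\<theta> n x)))
      \<le> ennreal (exp K) * (\<Sum>B\<in>\<beta>. SUP x\<in>B. ennreal (exp (\<phi> n x)))"
    unfolding sum_distrib_left using finite_subcovers_subset[OF \<beta>]
    by (intro sum_mono le_cmult_SUP_ennreal exp_le_cmult_exp le) auto
qed

lemma spanning_inf_le_cmult:
  "spanning_inf X T \<theta> n \<epsilon> \<le> ennreal (exp K) * spanning_inf X T \<phi> n \<epsilon>"
  unfolding spanning_inf_def
  by (intro le_cmult_INF_ennreal le_cmult_infsum_ennreal exp_le_cmult_exp le)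
     (auto simp: spanning_def)

lemma separated_sup_le_cmult:
  "separated_sup X T \<theta> n \<epsilon> \<le> ennreal (exp K) * separated_sup X T \<phi> n \<epsilon>"
  unfolding separated_sup_def
  by (intro le_cmult_SUP_ennreal le_cmult_infsum_ennreal exp_le_cmult_exp le)
     (auto simp: separated_def)

end

section \<open>Extended logarithms and growth rates\<close>

lemma ln_ennreal_0 [simp]: "ln_ennreal 0 = - \<infinity>"
  and ln_ennreal_top [simp]: "ln_ennreal top = \<infinity>"
  by (simp_all add: ln_ennreal_def)

lemma ln_ennreal_exp [simp]: "ln_ennreal (ennreal (exp r)) = ereal r"
  by (simp add: ln_ennreal_def)

text \<open>Writing finite positive values as exponentials lets \<open>ln_ennreal\<close> be
  evaluated in each case by a simp rule.\<close>

lemma ennreal_cases_exp [case_names zero top exp]: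
  fixes a :: ennreal
  obtains "a = 0" | "a = top" | r where "a = ennreal (exp r)"
proof (cases a)
  case (real u)
  then show ?thesis using that(1) that(3)[of "ln u"] by (cases "u = 0") auto
qed (use that in auto)

lemma ln_ennreal_mono: "a \<le> b \<Longrightarrow> ln_ennreal a \<le> ln_ennreal b"
  by (cases a rule: ennreal_cases_exp; cases b rule: ennreal_cases_exp) (auto simp: top_unique)

lemma ln_ennreal_exp_mult: "ln_ennreal (ennreal (exp K) * a) = ereal K + ln_ennreal a"
  by (cases a rule: ennreal_cases_exp)
     (auto simp: ennreal_mult_top simp flip: ennreal_mult exp_add)

text \<open>A positive real factor preserves each infinity, hence also the convention
  \<open>\<infinity> + (- \<infinity>) = \<infinity>\<close>; for \<open>r = 0\<close> both sides
  vanish.\<close>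

lemma ereal_real_distrib_left:
  "0 \<le> r \<Longrightarrow> ereal r * (a + b) = ereal r * a + ereal r * b"
  by (cases "r = 0"; cases a; cases b) (auto simp: algebra_simps simp flip: zero_ereal_def)

lemma growth_rate_mono:
  assumes "\<And>n. n \<ge> 1 \<Longrightarrow> a n \<le> b n"
  shows "growth_rate s a \<le> growth_rate s b"
  unfolding growth_rate_def
\<comment> \<open>The assumption says nothing about index \<open>0\<close>, which the limsup
  ignores.\<close>
proof (rule Limsup_mono, rule eventually_sequentiallyI[of 1])
  fix n :: nat assume "1 \<le> n"
  then show "ereal (1 / real n powr s) * ln_ennreal (a n)
      \<le> ereal (1 / real n powr s) * ln_ennreal (b n)"
    by (intro ereal_mult_left_mono ln_ennreal_mono assms) auto
qed

text \<open>Under the logarithm the factor becomes a summand \<open>K / real n powr s\<close>, which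
  tends to \<open>0\<close> because \<open>s > 0\<close>; adding a null sequence does not change a
  limsup.\<close>

lemma growth_rate_exp_cmult:
  assumes "s > 0"
  shows "growth_rate s (\<lambda>n. ennreal (exp K) * a n) = growth_rate s a"
proof -
  have "(\<lambda>n. K * real n powr - s) \<longlonglongrightarrow> K * 0"
    using assms by (intro tendsto_mult_left tendsto_neg_powr filterlim_real_sequentially) auto
  then have "(\<lambda>n. K / real n powr s) \<longlonglongrightarrow> 0"
    by (simp add: powr_minus_divide)
  then have "(\<lambda>n. ereal (K / real n powr s)) \<longlonglongrightarrow> ereal 0"
    by (rule tendsto_ereal)
  from ereal_limsup_lim_add[OF this, of "\<lambda>n. ereal (1 / real n powr s) * ln_ennreal (a n)"]
  show ?thesis
    by (simp add: growth_rate_def ln_ennreal_exp_mult ereal_real_distrib_left zero_ereal_def[symmetric])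
qed

lemma growth_rate_le_cmult:
  assumes "s > 0" and "\<And>n. n \<ge> 1 \<Longrightarrow> a n \<le> ennreal (exp K) * b n"
  shows "growth_rate s a \<le> growth_rate s b"
  unfolding growth_rate_exp_cmult[OF assms(1), of K b, symmetric]
  using assms(2) by (rule growth_rate_mono)

section \<open>The limit over scales as a supremum\<close>

lemma Lim_at_right_antitone:
  fixes f :: "real \<Rightarrow> ereal"
  assumes "\<And>x y. a < x \<Longrightarrow> x \<le> y \<Longrightarrow> f y \<le> f x"
  shows "Lim (at_right a) f = (SUP x\<in>{a<..}. f x)"
proof (rule tendsto_Lim)
  show "(f \<longlongrightarrow> (SUP x\<in>{a<..}. f x)) (at_right a)"
  proof (rule increasing_tendsto)
    show "\<forall>\<^sub>F x in at_right a. f x \<le> (SUP x\<in>{a<..}. f x)"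
      by (auto simp: eventually_at_filter intro!: always_eventually SUP_upper)
    fix l assume "l < (SUP x\<in>{a<..}. f x)"
    then obtain b where b: "a < b" "l < f b" by (auto simp: less_SUP_iff)
    \<comment> \<open>Every \<open>x\<close> between \<open>a\<close> and \<open>b\<close> satisfies
      \<open>f x \<ge> f b > l\<close>.\<close>
    show "\<forall>\<^sub>F x in at_right a. l < f x"
      unfolding eventually_at_right[OF b(1)]
      using b assms by (meson less_imp_le less_le_trans)
  qed
qed simp

text \<open>A set spanning at the finer scale also spans at the coarser one, so the infimum at
  \<open>\<delta>\<close> runs over more sets. For separated sets the inclusion is reversed, but so
  is infimum to supremum.\<close>

lemma spanning_inf_antitone:
  "\<epsilon> \<le> \<delta> \<Longrightarrow> spanning_inf X T \<phi> n \<delta> \<le> spanning_inf X T \<phi> n \<epsilon>"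
  unfolding spanning_inf_def spanning_def
  by (rule INF_superset_mono) (auto, meson less_le_trans)

lemma separated_sup_antitone:
  "\<epsilon> \<le> \<delta> \<Longrightarrow> separated_sup X T \<phi> n \<delta> \<le> separated_sup X T \<phi> n \<epsilon>"
  unfolding separated_sup_def separated_def
  by (rule SUP_subset_mono) (auto intro: le_less_trans)

text \<open>As a supremum, the pressure can be estimated one scale at a time, just as
  \<open>PD1\<close> and \<open>PD4\<close> are estimated one cover at a time.\<close>

lemma PD2_eq_SUP:
  "PD2 s X T \<phi> = (SUP \<epsilon>\<in>{0<..}. growth_rate s (\<lambda>n. spanning_inf X T \<phi> n \<epsilon>))"
  unfolding PD2_def
  by (intro Lim_at_right_antitone growth_rate_mono spanning_inf_antitone)

lemma PD3_eq_SUP: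
  "PD3 s X T \<phi> = (SUP \<epsilon>\<in>{0<..}. growth_rate s (\<lambda>n. separated_sup X T \<phi> n \<epsilon>))"
  unfolding PD3_def
  by (intro Lim_at_right_antitone growth_rate_mono separated_sup_antitone)

section \<open>Pressures under bounded perturbations and coboundaries\<close>

lemma PD_mono_bounded:
  assumes "s > 0" and le: "\<And>n x. n \<ge> 1 \<Longrightarrow> x \<in> X \<Longrightarrow> \<theta> n x \<le> \<phi> n x + K"
  shows "PD1 s X T \<theta> \<le> PD1 s X T \<phi>" and "PD2 s X T \<theta> \<le> PD2 s X T \<phi>"
    and "PD3 s X T \<theta> \<le> PD3 s X T \<phi>" and "PD4 s X T \<theta> \<le> PD4 s X T \<phi>"
proof -
  \<comment> \<open>All four pressures are suprema of growth rates, so comparing the rates for each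
    cover or scale suffices; \<open>K\<close> is the same for all \<open>n\<close>.\<close>
  note rate = growth_rate_le_cmult[OF \<open>s > 0\<close>, where K = K]
  note defs = PD1_def PD2_eq_SUP PD3_eq_SUP PD4_def
  show "PD1 s X T \<theta> \<le> PD1 s X T \<phi>"
    unfolding defs by (rule SUP_mono', rule rate, rule cover_inf_le_cmult, rule le)
  show "PD2 s X T \<theta> \<le> PD2 s X T \<phi>"
    unfolding defs by (rule SUP_mono', rule rate, rule spanning_inf_le_cmult, rule le)
  show "PD3 s X T \<theta> \<le> PD3 s X T \<phi>"
    unfolding defs by (rule SUP_mono', rule rate, rule separated_sup_le_cmult, rule le)
  show "PD4 s X T \<theta> \<le> PD4 s X T \<phi>"
    unfolding defs by (rule SUP_mono', rule rate, rule cover_sup_le_cmult, rule le)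
qed

lemma almost_additive_coboundary_bounded:
  assumes "tds X T" and "almost_additive X T \<psi>"
  obtains K where "\<And>n x. n \<ge> 1 \<Longrightarrow> x \<in> X \<Longrightarrow> \<bar>\<psi> n (T x) - \<psi> n x\<bar> \<le> K"
proof -
  have X: "compact X" and T: "\<And>x. x \<in> X \<Longrightarrow> T x \<in> X"
    using assms(1) by (auto simp: tds_def)
  obtain C where C: "\<And>n m x. n \<ge> 1 \<Longrightarrow> m \<ge> 1 \<Longrightarrow> x \<in> X \<Longrightarrow>
        - C + \<psi> n x + \<psi> m ((T ^^ n) x) \<le> \<psi> (n + m) x \<and>
        \<psi> (n + m) x \<le> \<psi> n x + \<psi> m ((T ^^ n) x) + C"
    and cont: "continuous_on X (\<psi> 1)"
    using assms(2) unfolding almost_additive_def by (metis order_refl)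
  have "bounded (\<psi> 1 ` X)"
    using X cont by (intro compact_imp_bounded compact_continuous_image)
  then obtain M where M: "\<And>x. x \<in> X \<Longrightarrow> \<bar>\<psi> 1 x\<bar> \<le> M"
    by (auto simp: bounded_iff)
  have orbit: "(T ^^ n) x \<in> X" if "x \<in> X" for n x
    using that T by (induction n) auto
  \<comment> \<open>Both \<open>\<psi> 1 x + \<psi> n (T x)\<close> and
    \<open>\<psi> n x + \<psi> 1 ((T ^^ n) x)\<close> lie within \<open>C\<close> of
    \<open>\<psi> (n + 1) x\<close>, and each of the two values of \<open>\<psi> 1\<close> costs at
    most \<open>M\<close>.\<close>
  have "\<bar>\<psi> n (T x) - \<psi> n x\<bar> \<le> 2 * (C + M)" if "n \<ge> 1" "x \<in> X" for n x
    using C[of 1 n x] C[of n 1 x] M[OF \<open>x \<in> X\<close>] M[OF orbit[OF \<open>x \<in> X\<close>, of n]] that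
    by (auto simp: add.commute[of 1 n] abs_le_iff)
  then show ?thesis by (rule that)
qed

section \<open>Hoelder's inequality and convexity of \<open>PD3\<close>\<close>

lemma exp_convex_combination_le:
  fixes p q a b t :: real
  assumes "0 \<le> t" "t \<le> 1"
  shows "exp (t * p + (1 - t) * q)
    \<le> exp (t * a + (1 - t) * b) * (t * exp (- a) * exp p + (1 - t) * exp (- b) * exp q)"
proof -
  \<comment> \<open>Young's inequality, centred at \<open>a\<close> and \<open>b\<close>, which
    later become the logarithms of bounds on the two sums.\<close>
  have "exp (t * p + (1 - t) * q)
      = exp (t * a + (1 - t) * b) * exp (t * (p - a) + (1 - t) * (q - b))"
    by (simp flip: exp_add add: algebra_simps)
  also have "\<dots> \<le> exp (t * a + (1 - t) * b) * (t * exp (p - a) + (1 - t) * exp (q - b))"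
    \<comment> \<open>\<open>convex_onD\<close> attaches its parameter to the second point, hence
      \<open>1 - t\<close>.\<close>
    using convex_onD[OF exp_convex, of "1 - t" "p - a" "q - b"] assms by simp
  also have "\<dots> = exp (t * a + (1 - t) * b) * (t * exp (- a) * exp p + (1 - t) * exp (- b) * exp q)"
    by (simp add: exp_diff exp_minus divide_inverse mult.commute)
  finally show ?thesis .
qed

text \<open>Hoelder's inequality with exponents \<open>1 / t\<close> and \<open>1 / (1 - t)\<close>,
  obtained by summing Young's inequality over \<open>E\<close>. Bounds of the form
  \<open>exp a\<close> avoid real powers in \<open>ennreal\<close>.\<close>

lemma infsum_exp_Hoelder:
  fixes f g :: "'b \<Rightarrow> real"
  assumes t: "0 \<le> t" "t \<le> 1"
    and f: "(\<Sum>\<^sub>\<infinity>x\<in>E. ennreal (exp (f x))) \<le> ennreal (exp a)"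
    and g: "(\<Sum>\<^sub>\<infinity>x\<in>E. ennreal (exp (g x))) \<le> ennreal (exp b)"
  shows "(\<Sum>\<^sub>\<infinity>x\<in>E. ennreal (exp (t * f x + (1 - t) * g x)))
    \<le> ennreal (exp (t * a + (1 - t) * b))"
proof -
  let ?c = "ennreal (exp (t * a + (1 - t) * b))"
  let ?u = "ennreal (t * exp (- a))" and ?v = "ennreal ((1 - t) * exp (- b))"
  have "(\<Sum>\<^sub>\<infinity>x\<in>E. ennreal (exp (t * f x + (1 - t) * g x)))
      \<le> ?c * (\<Sum>\<^sub>\<infinity>x\<in>E. ?u * ennreal (exp (f x)) + ?v * ennreal (exp (g x)))"
  proof (rule le_cmult_infsum_ennreal)
    fix x
    show "ennreal (exp (t * f x + (1 - t) * g x))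
        \<le> ?c * (?u * ennreal (exp (f x)) + ?v * ennreal (exp (g x)))"
      using t exp_convex_combination_le[OF t, of "f x" "g x" a b]
      by (simp flip: ennreal_mult ennreal_plus add: ennreal_leI)
  qed
  also have "\<dots> = ?c * (?u * (\<Sum>\<^sub>\<infinity>x\<in>E. ennreal (exp (f x))) + ?v * (\<Sum>\<^sub>\<infinity>x\<in>E. ennreal (exp (g x))))"
    by (subst infsum_add) (auto intro: nonneg_summable_on_complete simp: infsum_cmult_right_ennreal)
  also have "\<dots> \<le> ?c * (?u * ennreal (exp a) + ?v * ennreal (exp b))"
    by (intro mult_left_mono add_mono f g) auto
  \<comment> \<open>The centring cancels the two bounds and leaves
    \<open>t + (1 - t)\<close>.\<close>
  also have "?u * ennreal (exp a) + ?v * ennreal (exp b) = 1"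
    using t by (simp flip: ennreal_mult ennreal_plus exp_add add: mult.assoc)
  finally show ?thesis by simp
qed

text \<open>The criterion does not depend on \<open>\<phi>\<close>, so the partition functions of
  \<open>\<phi>\<close>, \<open>\<psi>\<close> and their convex combination vanish together.\<close>

lemma separated_sup_eq_0_iff:
  "separated_sup X T \<phi> n \<epsilon> = 0 \<longleftrightarrow> (\<forall>E. separated X T n \<epsilon> E \<longrightarrow> E = {})"
proof -
  have "(\<Sum>\<^sub>\<infinity>x\<in>E. ennreal (exp (\<phi> n x))) = 0 \<longleftrightarrow> E = {}" for E
  proof
    assume sum0: "(\<Sum>\<^sub>\<infinity>x\<in>E. ennreal (exp (\<phi> n x))) = 0"
    \<comment> \<open>A single positive term is a partial sum, hence a lower bound of the whole
      sum.\<close>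
    have "ennreal (exp (\<phi> n x)) \<le> 0" if "x \<in> E" for x
      using SUP_upper[of "{x}" "{F. finite F \<and> F \<subseteq> E}" "sum (\<lambda>x. ennreal (exp (\<phi> n x)))"]
        sum0 that by (simp add: nonneg_infsum_complete)
    then show "E = {}" by auto
  qed simp
  then show ?thesis
    by (simp add: separated_sup_def SUP_eq_iff bot_ennreal[symmetric])
qed

lemma ln_separated_sup_convex:
  assumes t: "0 < t" "t < 1"
  shows "ln_ennreal (separated_sup X T (\<lambda>n x. t * \<phi> n x + (1 - t) * \<psi> n x) n \<epsilon>)
    \<le> ereal t * ln_ennreal (separated_sup X T \<phi> n \<epsilon>)
      + ereal (1 - t) * ln_ennreal (separated_sup X T \<psi> n \<epsilon>)"
proof (cases "separated_sup X T \<phi> n \<epsilon> = 0")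
  case True
  then have "separated_sup X T (\<lambda>n x. t * \<phi> n x + (1 - t) * \<psi> n x) n \<epsilon> = 0"
    by (simp add: separated_sup_eq_0_iff)
  then show ?thesis by simp
next
  case False
  then have nz: "separated_sup X T \<psi> n \<epsilon> \<noteq> 0"
    by (simp add: separated_sup_eq_0_iff)
  show ?thesis
  proof (cases "separated_sup X T \<phi> n \<epsilon>" rule: ennreal_cases_exp)
    case (exp a)
    note a = this
    show ?thesis
    proof (cases "separated_sup X T \<psi> n \<epsilon>" rule: ennreal_cases_exp)
      case (exp b)
      have "separated_sup X T (\<lambda>n x. t * \<phi> n x + (1 - t) * \<psi> n x) n \<epsilon>
          \<le> ennreal (exp (t * a + (1 - t) * b))"
        unfolding separated_sup_def
      proof (rule SUP_least, rule infsum_exp_Hoelder)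
        fix E assume E: "E \<in> {E. separated X T n \<epsilon> E}"
        show "(\<Sum>\<^sub>\<infinity>x\<in>E. ennreal (exp (\<phi> n x))) \<le> ennreal (exp a)"
          unfolding a[symmetric] separated_sup_def using E by (rule SUP_upper)
        show "(\<Sum>\<^sub>\<infinity>x\<in>E. ennreal (exp (\<psi> n x))) \<le> ennreal (exp b)"
          unfolding exp[symmetric] separated_sup_def using E by (rule SUP_upper)
      qed (use t in auto)
      from ln_ennreal_mono[OF this] show ?thesis by (simp add: a exp)
    \<comment> \<open>The value \<open>0\<close> contradicts \<open>nz\<close>; the value
      \<open>top\<close> makes the right-hand side infinite because \<open>1 - t > 0\<close>. The
      outer case split closes in the same way with \<open>t > 0\<close>.\<close>
    qed (use nz t in auto)
  qed (use False t in auto)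
qed

text \<open>Subadditivity of limsup; an indeterminate sum on the right is \<open>\<infinity>\<close>
  and so bounds everything.\<close>

lemma limsup_convex_combination:
  fixes u v :: "nat \<Rightarrow> ereal"
  assumes "0 \<le> t" "t \<le> 1"
  shows "limsup (\<lambda>n. ereal t * u n + ereal (1 - t) * v n)
    \<le> ereal t * limsup u + ereal (1 - t) * limsup v"
proof -
  have "limsup (\<lambda>n. ereal r * w n) = ereal r * limsup w" if "0 \<le> r" for r and w :: "nat \<Rightarrow> ereal"
    using that by (intro Limsup_ereal_mult_left) auto
  then show ?thesis
    using ereal_limsup_add_mono[of "\<lambda>n. ereal t * u n" "\<lambda>n. ereal (1 - t) * v n"] assms by simp
qed

lemma PD3_convex:
  assumes "0 \<le> t" "t \<le> 1"
  shows "PD3 s X T (\<lambda>n x. t * \<phi> n x + (1 - t) * \<psi> n x)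
    \<le> ereal t * PD3 s X T \<phi> + ereal (1 - t) * PD3 s X T \<psi>"
proof -
  \<comment> \<open>\<open>ln_separated_sup_convex\<close> covers the open interval; at the
    endpoints \<open>0 * \<infinity> = 0\<close> turns the claim into an equality.\<close>
  consider "t = 0" | "t = 1" | "0 < t" "t < 1" using assms by linarith
  then show ?thesis
  proof cases
    case 3
    show ?thesis
      unfolding PD3_eq_SUP
    proof (rule SUP_least)
      fix \<epsilon> :: real assume \<epsilon>: "\<epsilon> \<in> {0<..}"
      let ?P = "\<lambda>\<phi> n. separated_sup X T \<phi> n \<epsilon>"
      let ?L = "\<lambda>\<phi> n. ereal (1 / real n powr s) * ln_ennreal (?P \<phi> n)"
      have "growth_rate s (?P (\<lambda>n x. t * \<phi> n x + (1 - t) * \<psi> n x))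
          \<le> limsup (\<lambda>n. ereal t * ?L \<phi> n + ereal (1 - t) * ?L \<psi> n)"
        unfolding growth_rate_def
      \<comment> \<open>The estimate holds at every index, including \<open>n = 0\<close>, since
        Hoelder's inequality is applied to one and the same set \<open>E\<close> whatever separation
        means.\<close>
      proof (rule Limsup_mono, rule always_eventually, rule allI)
        fix n
        have "?L (\<lambda>n x. t * \<phi> n x + (1 - t) * \<psi> n x) n
            \<le> ereal (1 / real n powr s) *
              (ereal t * ln_ennreal (?P \<phi> n) + ereal (1 - t) * ln_ennreal (?P \<psi> n))"
          using 3 by (intro ereal_mult_left_mono ln_separated_sup_convex) auto
        also have "\<dots> = ereal t * ?L \<phi> n + ereal (1 - t) * ?L \<psi> n"
          by (simp only: ereal_real_distrib_left[of "1 / real n powr s"] zero_le_divide_iff powr_ge_zero zero_le_one simp_thms mult.left_commute)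
        finally show "?L (\<lambda>n x. t * \<phi> n x + (1 - t) * \<psi> n x) n
            \<le> ereal t * ?L \<phi> n + ereal (1 - t) * ?L \<psi> n" .
      qed
      also have "\<dots> \<le> ereal t * growth_rate s (?P \<phi>) + ereal (1 - t) * growth_rate s (?P \<psi>)"
        unfolding growth_rate_def using assms by (rule limsup_convex_combination)
      also have "\<dots> \<le> ereal t * (SUP \<epsilon>\<in>{0<..}. growth_rate s (\<lambda>n. separated_sup X T \<phi> n \<epsilon>))
          + ereal (1 - t) * (SUP \<epsilon>\<in>{0<..}. growth_rate s (\<lambda>n. separated_sup X T \<psi> n \<epsilon>))"
        using assms \<epsilon> by (intro add_mono ereal_mult_left_mono SUP_upper) auto
      finally show "growth_rate s (?P (\<lambda>n x. t * \<phi> n x + (1 - t) * \<psi> n x)) \<le> \<dots>" .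
    qed
  qed (simp_all flip: zero_ereal_def one_ereal_def)
qed

theorem theorem3p3:
  fixes X :: "'a::metric_space set" and T :: "'a \<Rightarrow> 'a"
    and \<phi> \<psi> :: "nat \<Rightarrow> 'a \<Rightarrow> real" and s :: real
  assumes "tds X T" and "s > 0"
    and "almost_additive X T \<phi>" and "almost_additive X T \<psi>"
  shows
    "(seq_le X \<phi> \<psi> \<longrightarrow>
        PD1 s X T \<phi> \<le> PD1 s X T \<psi> \<and> PD2 s X T \<phi> \<le> PD2 s X T \<psi> \<and>
        PD3 s X T \<phi> \<le> PD3 s X T \<psi> \<and> PD4 s X T \<phi> \<le> PD4 s X T \<psi>) \<and>
     (s > 1 \<longrightarrow>
        PD1 s X T (\<lambda>n x. \<phi> n x + \<psi> n (T x) - \<psi> n x) = PD1 s X T \<phi> \<and>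
        PD2 s X T (\<lambda>n x. \<phi> n x + \<psi> n (T x) - \<psi> n x) = PD2 s X T \<phi> \<and>
        PD3 s X T (\<lambda>n x. \<phi> n x + \<psi> n (T x) - \<psi> n x) = PD3 s X T \<phi> \<and>
        PD4 s X T (\<lambda>n x. \<phi> n x + \<psi> n (T x) - \<psi> n x) = PD4 s X T \<phi>) \<and>
     (\<forall>t\<in>{0..1}.
        PD3 s X T (\<lambda>n x. t * \<phi> n x + (1 - t) * \<psi> n x)
          \<le> ereal t * PD3 s X T \<phi> + ereal (1 - t) * PD3 s X T \<psi>)"
proof -
  note bound = PD_mono_bounded[OF \<open>s > 0\<close>, where X = X and T = T]
  obtain K where K: "\<And>n x. n \<ge> 1 \<Longrightarrow> x \<in> X \<Longrightarrow> \<bar>\<psi> n (T x) - \<psi> n x\<bar> \<le> K"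
    using almost_additive_coboundary_bounded[OF assms(1,4)] by blast
  let ?\<theta> = "\<lambda>n x. \<phi> n x + \<psi> n (T x) - \<psi> n x"
  \<comment> \<open>The bound on the coboundary is two-sided, so each sequence dominates the other
    up to \<open>K\<close> and equality follows by antisymmetry.\<close>
  have up: "?\<theta> n x \<le> \<phi> n x + K" and lo: "\<phi> n x \<le> ?\<theta> n x + K" if "n \<ge> 1" "x \<in> X" for n x
    using K[OF that] by (simp_all add: abs_le_iff)
  show ?thesis
  proof (intro conjI impI ballI)
    assume "seq_le X \<phi> \<psi>"
    then have "\<phi> n x \<le> \<psi> n x + 0" if "n \<ge> 1" "x \<in> X" for n x
      using that by (simp add: seq_le_def)
    note bound[where \<theta> = \<phi> and \<phi> = \<psi> and K = 0, OF this]
    then show "PD1 s X T \<phi> \<le> PD1 s X T \<psi>" "PD2 s X T \<phi> \<le> PD2 s X T \<psi>"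
      "PD3 s X T \<phi> \<le> PD3 s X T \<psi>" "PD4 s X T \<phi> \<le> PD4 s X T \<psi>"
      by simp_all
  next
    note bound[where \<theta> = ?\<theta> and \<phi> = \<phi> and K = K, OF up]
      bound[where \<theta> = \<phi> and \<phi> = ?\<theta> and K = K, OF lo]
    then show "PD1 s X T ?\<theta> = PD1 s X T \<phi>" "PD2 s X T ?\<theta> = PD2 s X T \<phi>"
      "PD3 s X T ?\<theta> = PD3 s X T \<phi>" "PD4 s X T ?\<theta> = PD4 s X T \<phi>"
      by (simp_all add: order_antisym)
  next
    fix t :: real assume "t \<in> {0..1}"
    then show "PD3 s X T (\<lambda>n x. t * \<phi> n x + (1 - t) * \<psi> n x)
        \<le> ereal t * PD3 s X T \<phi> + ereal (1 - t) * PD3 s X T \<psi>"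
      by (intro PD3_convex) auto
  qed
qed

end
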